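(* Let $n>1$ be a positive integer. Then all idempotents $a(X)$ in $M_2(\mathbb{Z}_n[[X]])$ are obtained in the following way. We present $n$ as a product $n=PQR$ of three pairwise coprime positive integers $P,Q,R$. If $P>1$, we choose three power series $\alpha(X),\beta(X),\gamma(X)\in\mathbb{Z}[[X]]$ such that $\alpha(X)(1-\alpha(X))\equiv\beta(X)\gamma(X)\pmod P$. Then modulo $n$ $$a(X)\equiv\begin{pmatrix}\overline{\alpha}(X)&\overline{\beta}(X)\\ \overline{\gamma}(X)&1-\overline{\alpha}(X)\end{pmatrix},$$ where: (i) If $P,Q,R>1$, then $$\overline{\alpha}(X)\equiv\bigl(\alpha(X)+(1-\alpha(X))P^{\varphi(Q)}\bigr)\bigl(1-(PQ)^{\varphi(R)}\bigr),$$ $$\overline{\beta}(X)\equiv\beta(X)\bigl(1-P^{\varphi(Q)\varphi(R)}\bigr),\qquad \overline{\gamma}(X)\equiv\gamma(X)\bigl(1-P^{\varphi(Q)\varphi(R)}\bigr);$$ (ii) If $P,Q>1$, $R=1$, then $$\overline{\alpha}(X)\equiv\alpha(X)+(1-\alpha(X))P^{\varphi(Q)},\qquad \overline{\beta}(X)\equiv\beta(X)\bigl(1-P^{\varphi(Q)}\bigr),\qquad \overline{\gamma}(X)\equiv\gamma(X)\bigl(1-P^{\varphi(Q)}\bigr);$$ (iii) If $P,R>1$, $Q=1$, then $$\overline{\alpha}(X)\equiv\alpha(X)\bigl(1-P^{\varphi(R)}\bigr),\qquad \overline{\beta}(X)\equiv\beta(X)\bigl(1-P^{\varphi(R)}\bigr),\qquad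 \overline{\gamma}(X)\equiv\gamma(X)\bigl(1-P^{\varphi(R)}\bigr);$$ (iv) If $P=1$, $Q,R>1$, then $\overline{\alpha}(X)\equiv 1-Q^{\varphi(R)}$, $\overline{\beta}(X)\equiv\overline{\gamma}(X)\equiv 0$; (v) If $P>1$, $Q=R=1$, then $\overline{\alpha}(X)\equiv\alpha(X)$, $\overline{\beta}(X)\equiv\beta(X)$, $\overline{\gamma}(X)\equiv\gamma(X)$; (vi) If $P=R=1$, $Q>1$, then $a(X)\equiv I_2$; (vii) If $P=Q=1$, $R>1$, then $a(X)\equiv 0_2$, and $\varphi$ is the Euler totient function.
   Context: An element $a$ of a ring is called an idempotent if $a^2=a$. $X$ is an arbitrary (possibly infinite) set of commuting variables, and for a commutative ring $A$ with unity, $A[[X]]$ is the ring of formal power series in $X$ with coefficients in $A$. $\mathbb{Z}_n=\mathbb{Z}/n\mathbb{Z}$ is the ring of integers modulo $n$, and $M_2(\mathbb{Z}_n[[X]])$ is the ring of $2\times 2$ matrices with entries in $\mathbb{Z}_n[[X]]$. $I_2$ and $0_2$ are the identity and the zero $2\times 2$ matrices. Congruences between power series or matrices of power series are coefficientwise; those in (i)–(vii) are modulo $n$.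
   Formalization: The lower right entry is the bar formula for α applied to 1−α, not 1 minus ᾱ; as printed, every matrix in (i)–(v) has trace 1, so the idempotent 3I₂ for n=6 would be missed. *)

theory Defs
  imports
    "HOL-Analysis.Analysis"
    "HOL-Library.Multiset"
    "Berlekamp_Zassenhaus.Finite_Field"
begin

text \<open>
  A monomial is a finite multiset of variables, and a power series is an arbitrary
  coefficient function on monomials. If there are infinitely many variables, this is the
  full ring: infinitely many monomials of the same degree may occur in one series.
\<close>

typedef ('x, 'a) pseries = "UNIV :: ('x multiset \<Rightarrow> 'a) set"
  morphisms coeff_ps Abs_pseries ..

setup_lifting type_definition_pseries

lemma pseries_eqI: "(\<And>m. coeff_ps f m = coeff_ps g m) \<Longrightarrow> f = g"
  by transfer auto

lemma finite_submultisets: "finite {p. p \<subseteq># (m :: 'x multiset)}"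
proof (induction m)
  case empty
  then show ?case by simp
next
  case (add x m)
  have "{p. p \<subseteq># add_mset x m} \<subseteq> {p. p \<subseteq># m} \<union> add_mset x ` {p. p \<subseteq># m}"
  proof
    fix p assume "p \<in> {p. p \<subseteq># add_mset x m}"
    hence p: "p \<subseteq># add_mset x m" by simp
    show "p \<in> {p. p \<subseteq># m} \<union> add_mset x ` {p. p \<subseteq># m}"
    proof (cases "x \<in># p")
      case True
      then obtain q where "p = add_mset x q" by (metis insert_DiffM)
      with p show ?thesis by auto
    next
      case False
      hence "count p x = 0" by (simp add: not_in_iff)
      moreover have "count p y \<le> count (add_mset x m) y" for y
        using p by (rule mset_subset_eq_count)
      ultimately have "count p y \<le> count m y" for y
        by (cases "y = x") (simp, metis count_add_mset)
      thus ?thesis by (simp add: subseteq_mset_def)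
    qed
  qed
  with add show ?case by (meson finite_UnI finite_imageI finite_subset)
qed

lemma finite_mset_splits: "finite {(p, q). p + q = (m :: 'x multiset)}"
  by (rule finite_subset[of _ "{p. p \<subseteq># m} \<times> {p. p \<subseteq># m}"])
    (auto simp: finite_submultisets)

instantiation pseries :: (type, zero) zero
begin
lift_definition zero_pseries :: "('a, 'b) pseries" is "\<lambda>m. 0" .
instance ..
end

instantiation pseries :: (type, "{zero, one}") one
begin
lift_definition one_pseries :: "('a, 'b) pseries" is "\<lambda>m. if m = {#} then 1 else 0" .
instance ..
end

instantiation pseries :: (type, plus) plus
begin
lift_definition plus_pseries :: "('a, 'b) pseries \<Rightarrow> ('a, 'b) pseries \<Rightarrow> ('a, 'b) pseries"
  is "\<lambda>f g m. f m + g m" .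
instance ..
end

instantiation pseries :: (type, minus) minus
begin
lift_definition minus_pseries :: "('a, 'b) pseries \<Rightarrow> ('a, 'b) pseries \<Rightarrow> ('a, 'b) pseries"
  is "\<lambda>f g m. f m - g m" .
instance ..
end

instantiation pseries :: (type, uminus) uminus
begin
lift_definition uminus_pseries :: "('a, 'b) pseries \<Rightarrow> ('a, 'b) pseries"
  is "\<lambda>f m. - f m" .
instance ..
end

instantiation pseries :: (type, comm_semiring_0) times
begin
lift_definition times_pseries :: "('a, 'b) pseries \<Rightarrow> ('a, 'b) pseries \<Rightarrow> ('a, 'b) pseries"
  is "\<lambda>f g m. \<Sum>(p, q) | p + q = m. f p * g q" .
instance ..
end

instance pseries :: (type, comm_ring) ab_group_add
  by standard (transfer; simp add: fun_eq_iff algebra_simps)+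

instance pseries :: (type, comm_ring) comm_ring
proof
  fix f g h :: "('a, 'b) pseries"
  show "f * g * h = f * (g * h)"
  proof (transfer, rule ext)
    fix f g h :: "'a multiset \<Rightarrow> 'b" and m
    have "(\<Sum>(s, r) | s + r = m. (\<Sum>(p, q) | p + q = s. f p * g q) * h r) =
        (\<Sum>x | fst x + snd x = m. \<Sum>y | fst y + snd y = fst x. f (fst y) * g (snd y) * h (snd x))"
      by (simp add: split_def sum_distrib_right)
    also have "\<dots> = (\<Sum>(x, y) \<in> Sigma {x. fst x + snd x = m} (\<lambda>x. {y. fst y + snd y = fst x}).
        f (fst y) * g (snd y) * h (snd x))"
      by (rule sum.Sigma) (use finite_mset_splits in \<open>auto simp: split_def\<close>)
    also have "\<dots> = (\<Sum>(x, y) \<in> Sigma {x. fst x + snd x = m} (\<lambda>x. {y. fst y + snd y = snd x}).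
        f (fst x) * (g (fst y) * h (snd y)))"
      by (rule sum.reindex_bij_witness[of _ "\<lambda>(x, y). ((fst x + fst y, snd y), (fst x, fst y))"
            "\<lambda>(x, y). ((fst y, snd y + snd x), (snd y, snd x))"])
        (auto simp: add.assoc mult.assoc)
    also have "\<dots> = (\<Sum>x | fst x + snd x = m. \<Sum>y | fst y + snd y = snd x.
        f (fst x) * (g (fst y) * h (snd y)))"
      by (rule sum.Sigma[symmetric]) (use finite_mset_splits in \<open>auto simp: split_def\<close>)
    also have "\<dots> = (\<Sum>(p, s) | p + s = m. f p * (\<Sum>(q, r) | q + r = s. g q * h r))"
      by (simp add: split_def sum_distrib_left)
    finally show "(\<Sum>(s, r) | s + r = m. (\<Sum>(p, q) | p + q = s. f p * g q) * h r) =
        (\<Sum>(p, s) | p + s = m. f p * (\<Sum>(q, r) | q + r = s. g q * h r))" .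
  qed
  show "f * g = g * f"
  proof (transfer, rule ext)
    fix f g :: "'a multiset \<Rightarrow> 'b" and m
    show "(\<Sum>(p, q) | p + q = m. f p * g q) = (\<Sum>(p, q) | p + q = m. g p * f q)"
      by (rule sum.reindex_bij_witness[of _ prod.swap prod.swap])
        (auto simp: add.commute mult.commute)
  qed
  show "(f + g) * h = f * h + g * h"
    by transfer (simp add: fun_eq_iff split_def distrib_right sum.distrib)
qed

instance pseries :: (type, comm_ring_1) comm_ring_1
proof
  fix f :: "('a, 'b) pseries"
  show "1 * f = f"
  proof (transfer, rule ext)
    fix f :: "'a multiset \<Rightarrow> 'b" and m
    have "(\<Sum>(p, q) | p + q = m. (if p = {#} then 1 else 0) * f q) =
        (\<Sum>x | fst x + snd x = m. if x = ({#}, m) then f m else 0)"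
      unfolding split_def by (rule sum.cong) (auto simp: prod_eq_iff)
    also have "\<dots> = f m"
      using finite_mset_splits[of m] by (simp add: sum.delta split_def)
    finally show "(\<Sum>(p, q) | p + q = m. (if p = {#} then 1 else 0) * f q) = f m" .
  qed
  show "(0 :: ('a, 'b) pseries) \<noteq> 1"
    by transfer (auto simp: fun_eq_iff)
qed

text \<open>The subring of the series that involve only variables from the set \<open>X\<close>.\<close>

definition pseries_in :: "'x set \<Rightarrow> ('x, 'a :: zero) pseries set" where
  "pseries_in X = {f. \<forall>m. coeff_ps f m \<noteq> 0 \<longrightarrow> set_mset m \<subseteq> X}"

lemma pseries_in_UNIV [simp]: "pseries_in UNIV = UNIV"
  by (simp add: pseries_in_def)

lemma pseries_in_subring:
  fixes f g :: "('x, 'a :: comm_ring_1) pseries"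
  shows "0 \<in> pseries_in X" "1 \<in> pseries_in X"
    and "f \<in> pseries_in X \<Longrightarrow> - f \<in> pseries_in X"
    and "f \<in> pseries_in X \<Longrightarrow> g \<in> pseries_in X \<Longrightarrow> f + g \<in> pseries_in X"
    and "f \<in> pseries_in X \<Longrightarrow> g \<in> pseries_in X \<Longrightarrow> f * g \<in> pseries_in X"
proof -
  show "0 \<in> pseries_in X" "1 \<in> pseries_in X"
    by (auto simp: pseries_in_def zero_pseries.rep_eq one_pseries.rep_eq)
  show "f \<in> pseries_in X \<Longrightarrow> - f \<in> pseries_in X"
    by (auto simp: pseries_in_def uminus_pseries.rep_eq)
  assume fg: "f \<in> pseries_in X" "g \<in> pseries_in X"
  have "set_mset m \<subseteq> X" if "coeff_ps (f + g) m \<noteq> 0" for m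
  proof (cases "coeff_ps f m = 0")
    case True
    with that have "coeff_ps g m \<noteq> 0" by (simp add: plus_pseries.rep_eq)
    with fg show ?thesis by (simp add: pseries_in_def)
  next
    case False
    with fg show ?thesis by (simp add: pseries_in_def)
  qed
  thus "f + g \<in> pseries_in X" by (simp add: pseries_in_def)
  show "f * g \<in> pseries_in X"
    unfolding pseries_in_def
  proof safe
    fix m x assume "coeff_ps (f * g) m \<noteq> 0" and x: "x \<in># m"
    hence "(\<Sum>(p, q) | p + q = m. coeff_ps f p * coeff_ps g q) \<noteq> 0"
      by (simp add: times_pseries.rep_eq)
    then obtain z where "z \<in> {(p, q). p + q = m}"
        "(case z of (p, q) \<Rightarrow> coeff_ps f p * coeff_ps g q) \<noteq> 0"
      by (rule sum.not_neutral_contains_not_neutral)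
    then obtain p q where pq: "p + q = m" "coeff_ps f p * coeff_ps g q \<noteq> 0"
      by (cases z) auto
    hence "coeff_ps f p \<noteq> 0" "coeff_ps g q \<noteq> 0" by auto
    with fg have "set_mset p \<subseteq> X" "set_mset q \<subseteq> X" by (auto simp: pseries_in_def)
    with pq x show "x \<in> X" by auto
  qed
qed

definition cong_ps :: "('x, int) pseries \<Rightarrow> ('x, int) pseries \<Rightarrow> nat \<Rightarrow> bool" where
  "cong_ps f g k \<longleftrightarrow> (\<forall>m. [coeff_ps f m = coeff_ps g m] (mod int k))"

text \<open>
  Coefficientwise reduction of integer series modulo \<open>n = CARD('n)\<close>; the ring of integers
  modulo \<open>n\<close> is the type \<open>'n mod_ring\<close>.
\<close>

definition reduce_ps :: "('x, int) pseries \<Rightarrow> ('x, 'n :: nontriv mod_ring) pseries" where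
  "reduce_ps f = Abs_pseries (\<lambda>m. of_int (coeff_ps f m))"

lemma coeff_reduce_ps [simp]: "coeff_ps (reduce_ps f) m = of_int (coeff_ps f m)"
  by (simp add: reduce_ps_def Abs_pseries_inverse)

definition mat2 :: "'r :: zero \<Rightarrow> 'r \<Rightarrow> 'r \<Rightarrow> 'r \<Rightarrow> 'r ^ 2 ^ 2" where
  "mat2 a b c d = vector [vector [a, b], vector [c, d]]"

definition mat2_in :: "'r set \<Rightarrow> ('r ^ 2 ^ 2) set" where
  "mat2_in S = {A. \<forall>i j. A $ i $ j \<in> S}"

definition reduce_mat :: "('x, int) pseries ^ 2 ^ 2 \<Rightarrow> ('x, 'n :: nontriv mod_ring) pseries ^ 2 ^ 2" where
  "reduce_mat A = (\<chi> i j. reduce_ps (A $ i $ j))"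

text \<open>
  For pairwise coprime \<open>P\<close>, \<open>Q\<close>, \<open>R\<close> the following two operations lift a series given modulo
  \<open>P\<close> to a series modulo \<open>P * Q * R\<close>: \<open>diag_bar\<close> produces the series congruent to \<open>f\<close> modulo
  \<open>P\<close>, to 1 modulo \<open>Q\<close> and to 0 modulo \<open>R\<close>, and \<open>off_bar\<close> (used only for \<open>P > 1\<close>) the one
  congruent to \<open>f\<close> modulo \<open>P\<close> and to 0 modulo \<open>Q\<close> and \<open>R\<close>.
  If \<open>P = 1\<close>, then \<open>diag_bar\<close> does not depend on \<open>f\<close>.
\<close>

definition diag_bar :: "nat \<Rightarrow> nat \<Rightarrow> nat \<Rightarrow> ('x, int) pseries \<Rightarrow> ('x, int) pseries" where
  "diag_bar P Q R f =
    (if P > 1 \<and> Q > 1 \<and> R > 1 then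
       (f + (1 - f) * of_nat (P ^ totient Q)) * (1 - of_nat ((P * Q) ^ totient R))
     else if P > 1 \<and> Q > 1 \<and> R = 1 then f + (1 - f) * of_nat (P ^ totient Q)
     else if P > 1 \<and> Q = 1 \<and> R > 1 then f * (1 - of_nat (P ^ totient R))
     else if P = 1 \<and> Q > 1 \<and> R > 1 then 1 - of_nat (Q ^ totient R)
     else if P > 1 \<and> Q = 1 \<and> R = 1 then f
     else if P = 1 \<and> Q > 1 \<and> R = 1 then 1
     else 0)"

definition off_bar :: "nat \<Rightarrow> nat \<Rightarrow> nat \<Rightarrow> ('x, int) pseries \<Rightarrow> ('x, int) pseries" where
  "off_bar P Q R f =
    (if P > 1 \<and> Q > 1 \<and> R > 1 then f * (1 - of_nat (P ^ (totient Q * totient R)))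
     else if P > 1 \<and> Q > 1 \<and> R = 1 then f * (1 - of_nat (P ^ totient Q))
     else if P > 1 \<and> Q = 1 \<and> R > 1 then f * (1 - of_nat (P ^ totient R))
     else if P > 1 \<and> Q = 1 \<and> R = 1 then f
     else 0)"

text \<open>
  The lower right entry is the lift of \<open>1 - \<alpha>\<close>, not \<open>1\<close> minus the lift of \<open>\<alpha>\<close>: the
  matrix has to be the identity modulo \<open>Q\<close> and zero modulo \<open>R\<close>. With \<open>1 - diag_bar P Q R \<alpha>\<close>
  in this place the trace would always be 1, and for \<open>n = 6\<close> the idempotent \<open>3 I\<^sub>2\<close>, whose
  trace is 0 modulo 6, would be missed.
  The matrix is \<open>I\<^sub>2\<close> for \<open>P = R = 1 < Q\<close> and \<open>0\<^sub>2\<close> for \<open>P = Q = 1 < R\<close>.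
\<close>

definition idem_mat ::
  "nat \<Rightarrow> nat \<Rightarrow> nat \<Rightarrow> ('x, int) pseries \<Rightarrow> ('x, int) pseries \<Rightarrow> ('x, int) pseries \<Rightarrow>
    ('x, int) pseries ^ 2 ^ 2" where
  "idem_mat P Q R \<alpha> \<beta> \<gamma> =
    mat2 (diag_bar P Q R \<alpha>) (off_bar P Q R \<beta>) (off_bar P Q R \<gamma>) (diag_bar P Q R (1 - \<alpha>))"

lemma idem_mat_trivial_cases:
  "Q > 1 \<Longrightarrow> idem_mat 1 Q 1 \<alpha> \<beta> \<gamma> = mat 1"
  "R > 1 \<Longrightarrow> idem_mat 1 1 R \<alpha> \<beta> \<gamma> = 0"
  by (auto simp: idem_mat_def diag_bar_def off_bar_def mat2_def mat_def vec_eq_iff forall_2)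

end

theory Submission
  imports Defs
begin

text \<open>
  An idempotent matrix \<open>a\<close> of order two over a field has rank 0, 1 or 2. It is then the zero
  matrix, a matrix of trace 1 and determinant 0, or the identity matrix. The theorem says that over
  \<open>\<int>\<^sub>n[[X]]\<close> the rank can vary only with the modulus: \<open>n\<close> splits into coprime factors \<open>P\<close>, \<open>Q\<close>, \<open>R\<close>
  modulo which \<open>a\<close> has rank 1, 2 and 0.

  The ranks are read off from \<open>\<delta> = det a\<close> and \<open>\<epsilon> = det (1 - a)\<close>. Both are idempotent because the
  determinant is multiplicative, and multiplying \<open>a\<^sup>2 = a\<close> by the adjugate of \<open>a\<close> gives
  \<open>\<delta> (a - 1) = 0\<close>, likewise \<open>\<epsilon> a = 0\<close> (\<open>idempotent_mat2_det\<close>, \<open>idempotent_mat2_det_compl\<close>). So \<open>a\<close>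
  is the identity where \<open>\<delta> = 1\<close> and zero where \<open>\<epsilon> = 1\<close>. Where both vanish, the trace, which equals
  \<open>1 + \<delta> - \<epsilon>\<close>, is 1, so that the lower right entry is \<open>1 - \<alpha>\<close>, and the equation \<open>\<delta> = 0\<close>
  becomes \<open>\<alpha> (1 - \<alpha>) = \<beta> \<gamma>\<close>.

  These alternatives are realised by a factorisation of \<open>n\<close> because an idempotent power series is
  constant (\<open>idempotent_pseries_constant\<close>): \<open>\<delta>\<close> and \<open>\<epsilon>\<close> are residues of integers, and an integer
  \<open>e\<close> with \<open>n dvd e (1 - e)\<close> splits \<open>n\<close> into coprime factors modulo which \<open>e\<close> is 0 and 1
  (\<open>split_modulus_by_two_idempotents\<close>).

  On the other side, Euler's theorem shows that the explicit formulas solve the congruences that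
  characterise the three ranks (\<open>diag_bar_cong\<close>, \<open>off_bar_cong\<close>). By the Chinese remainder theorem
  those solutions are unique modulo \<open>n\<close>, so the given \<open>a\<close> is the matrix of the formulas; and a matrix
  which is idempotent modulo each of \<open>P\<close>, \<open>Q\<close>, \<open>R\<close> is idempotent modulo \<open>n\<close>.

  All congruences between integer series are written as divisibility by a constant in the ring
  \<open>\<int>[[X]]\<close>; this leaves only ring identities to check.
\<close>

section \<open>Idempotent power series\<close>

text \<open>
  Let \<open>m \<noteq> 1\<close> be a monomial of least degree whose coefficient \<open>f\<^sub>m\<close> might not vanish. In the
  coefficient of \<open>f\<^sup>2\<close> at \<open>m\<close> every factorisation of \<open>m\<close> into two smaller monomials contributes 0, and
  only \<open>2 f\<^sub>0 f\<^sub>m\<close> remains, where \<open>f\<^sub>0\<close> is the constant term. An idempotent \<open>f\<^sub>0\<close> in any commutative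
  ring makes \<open>f\<^sub>m = 2 f\<^sub>0 f\<^sub>m\<close> impossible unless \<open>f\<^sub>m = 0\<close>.
\<close>

lemma idempotent_pseries_constant:
  fixes f :: "('x, 'a :: comm_ring_1) pseries"
  assumes idem: "f * f = f" and "m \<noteq> {#}"
  shows "coeff_ps f m = 0"
  using \<open>m \<noteq> {#}\<close>
proof (induction "size m" arbitrary: m rule: less_induct)
  case less
  let ?c = "coeff_ps f" and ?S = "{(p, q). p + q = m}"
  have "?c m = (\<Sum>(p, q) \<in> ?S. ?c p * ?c q)"
    using idem by (metis times_pseries.rep_eq)
  also have "\<dots> = (\<Sum>(p, q) \<in> {({#}, m), (m, {#})}. ?c p * ?c q)"
  proof (rule sum.mono_neutral_right)
    show "\<forall>z \<in> ?S - {({#}, m), (m, {#})}. (case z of (p, q) \<Rightarrow> ?c p * ?c q) = 0"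
    proof
      fix z assume z: "z \<in> ?S - {({#}, m), (m, {#})}"
      obtain p q where "z = (p, q)" by fastforce
      with z have pq: "p + q = m" "p \<noteq> {#}" "q \<noteq> {#}" by auto
      then have "size p < size m"
        by (metis less_add_same_cancel1 nonempty_has_size size_union)
      with less.hyps pq have "?c p = 0" by blast
      with \<open>z = (p, q)\<close> show "(case z of (p, q) \<Rightarrow> ?c p * ?c q) = 0" by simp
    qed
  qed (auto simp: finite_mset_splits)
  also have "\<dots> = ?c {#} * ?c m + ?c m * ?c {#}"
    using less.prems by simp
  finally have lin: "?c m = ?c {#} * ?c m + ?c m * ?c {#}" .
  have "?c {#} = (\<Sum>(p, q) \<in> {(p, q). p + q = {#}}. ?c p * ?c q)"
    using idem by (metis times_pseries.rep_eq)
  also have "{(p, q). p + q = {#}} = {({#} :: 'x multiset, {#} :: 'x multiset)}" by auto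
  finally have c0: "?c {#} * ?c {#} = ?c {#}" by simp
  \<comment> \<open>Multiplying \<open>f\<^sub>m = 2 f\<^sub>0 f\<^sub>m\<close> by the idempotent \<open>f\<^sub>0\<close> gives \<open>f\<^sub>0 f\<^sub>m = 2 f\<^sub>0 f\<^sub>m\<close>.\<close>
  have "?c {#} * ?c m = ?c {#} * ?c {#} * ?c m + ?c {#} * ?c {#} * ?c m"
    by (subst lin) (simp add: algebra_simps)
  with c0 have "?c {#} * ?c m = 0" by simp
  with lin show "?c m = 0" by (simp add: mult.commute)
qed

section \<open>Divisibility and reduction of integer series\<close>

lemma coeff_ps_of_nat_mult:
  "coeff_ps (of_nat k * f) m = of_nat k * coeff_ps f m"
  by (induction k) (simp_all add: distrib_right plus_pseries.rep_eq zero_pseries.rep_eq)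

lemma of_nat_dvd_pseries_iff:
  fixes f :: "('x, int) pseries"
  shows "of_nat k dvd f \<longleftrightarrow> (\<forall>m. int k dvd coeff_ps f m)"
proof
  assume "\<forall>m. int k dvd coeff_ps f m"
  then obtain g where g: "coeff_ps f m = int k * g m" for m
    unfolding dvd_def by metis
  have "f = of_nat k * Abs_pseries g"
    by (rule pseries_eqI) (simp add: coeff_ps_of_nat_mult Abs_pseries_inverse g)
  then show "of_nat k dvd f" by simp
qed (auto simp: coeff_ps_of_nat_mult elim!: dvdE)

lemma cong_ps_iff_dvd: "cong_ps f g k \<longleftrightarrow> of_nat k dvd f - g"
  by (simp add: cong_ps_def of_nat_dvd_pseries_iff cong_iff_dvd_diff minus_pseries.rep_eq)

text \<open>The Chinese remainder theorem for series, in the form of uniqueness.\<close>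

lemma of_nat_mult_dvd_pseries:
  fixes f :: "('x, int) pseries"
  assumes "coprime P Q" "of_nat P dvd f" "of_nat Q dvd f"
  shows "of_nat (P * Q) dvd f"
  unfolding of_nat_dvd_pseries_iff
  using assms by (auto simp: of_nat_dvd_pseries_iff intro!: divides_mult)

lemma of_nat_dvd_of_int:
  assumes "int k dvd e"
  shows "(of_nat k :: 'a :: comm_ring_1) dvd of_int e"
proof -
  from assms obtain c where "e = int k * c" ..
  then show ?thesis by simp
qed

lemma coeff_ps_of_int:
  "coeff_ps (of_int e :: ('x, 'a :: comm_ring_1) pseries) m = (if m = {#} then of_int e else 0)"
proof -
  have nat: "coeff_ps (of_nat k :: ('x, 'a) pseries) m = (if m = {#} then of_nat k else 0)" for k
    using coeff_ps_of_nat_mult[of k 1 m] by (auto simp: one_pseries.rep_eq)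
  show ?thesis
    by (cases e rule: int_cases2) (simp_all add: nat uminus_pseries.rep_eq)
qed

lemma reduce_ps_eq_0_iff:
  "(reduce_ps f :: ('x, 'n :: nontriv mod_ring) pseries) = 0 \<longleftrightarrow> of_nat CARD('n) dvd f"
proof -
  have "(of_int k :: 'n mod_ring) = 0 \<longleftrightarrow> int CARD('n) dvd k" for k
    using of_int_eq_iff_cong_CHAR[of k 0, where 'a = "'n mod_ring"] by (simp add: cong_0_iff)
  moreover have "(reduce_ps f :: ('x, 'n mod_ring) pseries) = 0 \<longleftrightarrow>
      (\<forall>m. (of_int (coeff_ps f m) :: 'n mod_ring) = 0)"
    by (simp flip: coeff_ps_inject add: fun_eq_iff zero_pseries.rep_eq)
  ultimately show ?thesis by (simp add: of_nat_dvd_pseries_iff)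
qed

lemma reduce_ps_add: "reduce_ps (f + g) = reduce_ps f + reduce_ps g"
  and reduce_ps_diff: "reduce_ps (f - g) = reduce_ps f - reduce_ps g"
  and reduce_ps_mult: "reduce_ps (f * g) = reduce_ps f * reduce_ps g"
  and reduce_ps_of_int: "reduce_ps (of_int e) = of_int e"
  by (rule pseries_eqI; simp add: plus_pseries.rep_eq minus_pseries.rep_eq times_pseries.rep_eq
      coeff_ps_of_int split_def)+

lemma reduce_ps_1: "reduce_ps 1 = 1"
  using reduce_ps_of_int[of 1] by simp

lemmas reduce_ps_hom = reduce_ps_add reduce_ps_diff reduce_ps_mult reduce_ps_of_int reduce_ps_1

lemma reduce_ps_eq_iff:
  "(reduce_ps f :: ('x, 'n :: nontriv mod_ring) pseries) = reduce_ps g \<longleftrightarrow>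
    of_nat CARD('n) dvd f - g"
  by (simp flip: reduce_ps_eq_0_iff add: reduce_ps_diff)

lemma reduce_ps_in:
  assumes "f \<in> pseries_in X"
  shows "(reduce_ps f :: ('x, 'n :: nontriv mod_ring) pseries) \<in> pseries_in X"
proof -
  have "coeff_ps f m \<noteq> 0" if "coeff_ps (reduce_ps f :: ('x, 'n mod_ring) pseries) m \<noteq> 0" for m
    using that by (cases "coeff_ps f m = 0") simp_all
  with assms show ?thesis unfolding pseries_in_def by blast
qed

lemma reduce_ps_lift:
  fixes f :: "('x, 'n :: nontriv mod_ring) pseries"
  assumes "f \<in> pseries_in X"
  obtains g where "g \<in> pseries_in X" "reduce_ps g = f"
proof
  let ?g = "Abs_pseries (\<lambda>m. to_int_mod_ring (coeff_ps f m)) :: ('x, int) pseries"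
  show "?g \<in> pseries_in X"
    using assms by (auto simp: pseries_in_def Abs_pseries_inverse)
  show "reduce_ps ?g = f"
    by (rule pseries_eqI) (simp add: Abs_pseries_inverse of_int_of_int_mod_ring)
qed

lemma idempotent_reduced_pseries_of_int:
  fixes f :: "('x, 'n :: nontriv mod_ring) pseries"
  assumes "f * f = f"
  obtains e where "f = of_int e"
proof
  show "f = of_int (to_int_mod_ring (coeff_ps f {#}))"
    by (rule pseries_eqI)
      (simp add: coeff_ps_of_int of_int_of_int_mod_ring idempotent_pseries_constant[OF assms])
qed

section \<open>Lifting along the three coprime factors\<close>

lemma of_nat_dvd_of_nat_power:
  "0 < k \<Longrightarrow> (of_nat a :: 'a :: comm_ring_1) dvd of_nat (a ^ k)"
  by (simp add: dvd_power)

text \<open>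
  Euler's theorem. The factor \<open>k\<close> accommodates the exponent \<open>totient Q * totient R\<close>, which serves
  the moduli \<open>Q\<close> and \<open>R\<close> at once.
\<close>

lemma of_nat_dvd_power_totient_diff_1:
  assumes "coprime a m"
  shows "(of_nat m :: 'a :: comm_ring_1) dvd of_nat (a ^ (totient m * k)) - 1"
proof -
  have "[(a ^ totient m) ^ k = 1 ^ k] (mod m)"
    using assms by (intro cong_pow euler_theorem)
  then have "int m dvd int (a ^ (totient m * k)) - 1"
    by (simp add: power_mult flip: cong_int_iff cong_iff_dvd_diff)
  from of_nat_dvd_of_int[OF this] show ?thesis by simp
qed

text \<open>
  A power with totient exponent is 0 modulo its base and 1 modulo the other factor. Hence
  \<open>f + (1 - f) P\<^sup>\<phi>\<^sup>(\<^sup>Q\<^sup>)\<close> moves from \<open>f\<close> modulo \<open>P\<close> to 1 modulo \<open>Q\<close>, and the factor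
  \<open>1 - (P Q)\<^sup>\<phi>\<^sup>(\<^sup>R\<^sup>)\<close> then kills the result modulo \<open>R\<close> and leaves it alone modulo \<open>P\<close> and \<open>Q\<close>. Where
  a factor of the modulus is 1, the congruence modulo this factor is void, so that one statement
  covers all cases of the definition.
\<close>

lemma diag_bar_cong:
  fixes f :: "('x, int) pseries"
  assumes "P > 0" "Q > 0" "R > 0" "coprime P Q" "coprime P R" "coprime Q R"
  shows "of_nat P dvd diag_bar P Q R f - f"
    and "of_nat Q dvd diag_bar P Q R f - 1"
    and "of_nat R dvd diag_bar P Q R f"
proof -
  define p s t u where defs:
    "p = (of_nat (P ^ totient Q) :: ('x, int) pseries)"
    "s = (of_nat ((P * Q) ^ totient R) :: ('x, int) pseries)"
    "t = (of_nat (P ^ totient R) :: ('x, int) pseries)"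
    "u = (of_nat (Q ^ totient R) :: ('x, int) pseries)"
  have pos: "totient Q > 0" "totient R > 0" using assms by auto
  have small: "of_nat P dvd p" "of_nat (P * Q) dvd s" "of_nat P dvd t" "of_nat Q dvd u"
    unfolding defs using pos by (simp_all only: of_nat_dvd_of_nat_power)
  have s: "of_nat P dvd s" "of_nat Q dvd s"
    using small(2) unfolding of_nat_mult by (rule dvd_mult_left, rule dvd_mult_right)
  have unit: "of_nat Q dvd p - 1" "of_nat R dvd s - 1" "of_nat R dvd t - 1" "of_nat R dvd u - 1"
    unfolding defs using assms
    by (auto intro!: of_nat_dvd_power_totient_diff_1[where k = 1, unfolded mult_1_right]
        simp del: of_nat_power of_nat_mult)
  \<comment> \<open>Positivity makes the tests for 1 in the definition redundant.\<close>
  have bar: "diag_bar P Q R f =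
      (if P > 1 \<and> Q > 1 \<and> R > 1 then (f + (1 - f) * p) * (1 - s)
       else if P > 1 \<and> Q > 1 then f + (1 - f) * p
       else if P > 1 \<and> R > 1 then f * (1 - t)
       else if Q > 1 \<and> R > 1 then 1 - u
       else if P > 1 then f else if Q > 1 then 1 else 0)"
    using assms(1-3) by (auto simp: diag_bar_def defs simp del: of_nat_power of_nat_mult)
  show "of_nat P dvd diag_bar P Q R f - f"
  proof -
    have "(f + (1 - f) * p) * (1 - s) - f = p * ((1 - f) * (1 - s)) - s * f"
      and "f + (1 - f) * p - f = p * (1 - f)" and "f * (1 - t) - f = t * (- f)"
      by (simp_all add: algebra_simps)
    then have "of_nat P dvd (f + (1 - f) * p) * (1 - s) - f"
      "of_nat P dvd f + (1 - f) * p - f" "of_nat P dvd f * (1 - t) - f"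
      using small(1,3) s(1) by (simp_all only: dvd_diff dvd_mult2)
    then show ?thesis using assms(1) unfolding bar by (cases "P = 1") auto
  qed
  show "of_nat Q dvd diag_bar P Q R f - 1"
  proof -
    have "(f + (1 - f) * p) * (1 - s) - 1 = (p - 1) * ((1 - f) * (1 - s)) - s"
      and "f + (1 - f) * p - 1 = (p - 1) * (1 - f)" and "1 - u - 1 = - u"
      by (simp_all add: algebra_simps)
    then have "of_nat Q dvd (f + (1 - f) * p) * (1 - s) - 1"
      "of_nat Q dvd f + (1 - f) * p - 1" "of_nat Q dvd 1 - u - 1"
      using small(4) s(2) unit(1) by (simp_all only: dvd_diff dvd_mult2 dvd_minus_iff)
    then show ?thesis using assms(2) unfolding bar by (cases "Q = 1") auto
  qed
  show "of_nat R dvd diag_bar P Q R f"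
  proof -
    have "of_nat R dvd 1 - s" "of_nat R dvd 1 - t" "of_nat R dvd 1 - u"
      using unit(2-4) by (metis dvd_minus_iff minus_diff_eq)+
    then show ?thesis using assms(3) unfolding bar by (cases "R = 1") auto
  qed
qed

lemma off_bar_cong:
  fixes f :: "('x, int) pseries"
  assumes "P > 0" "Q > 0" "R > 0" "coprime P Q" "coprime P R" "coprime Q R"
  shows "of_nat P dvd off_bar P Q R f - f"
    and "of_nat Q dvd off_bar P Q R f"
    and "of_nat R dvd off_bar P Q R f"
proof -
  have pos: "totient Q > 0" "totient R > 0" using assms by auto
  have P: "of_nat P dvd f * (1 - of_nat (P ^ k)) - f" if "k > 0" for k
    using dvd_mult[OF of_nat_dvd_of_nat_power[OF that, where 'a = "('x, int) pseries"], of P "- f"]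
    by (simp add: algebra_simps)
  have E: "of_nat m dvd f * (1 - of_nat (P ^ (totient m * k)))" if "coprime P m" for m k
    using dvd_mult[OF of_nat_dvd_power_totient_diff_1[OF that, where 'a = "('x, int) pseries"], of "- f" k]
    by (simp add: algebra_simps)
  have bar: "off_bar P Q R f =
      (if P > 1 \<and> Q > 1 \<and> R > 1 then f * (1 - of_nat (P ^ (totient Q * totient R)))
       else if P > 1 \<and> Q > 1 then f * (1 - of_nat (P ^ totient Q))
       else if P > 1 \<and> R > 1 then f * (1 - of_nat (P ^ totient R))
       else if P > 1 then f else 0)"
    using assms(1-3) by (auto simp: off_bar_def simp del: of_nat_power of_nat_mult)
  note [simp del] = of_nat_power of_nat_mult
  show "of_nat P dvd off_bar P Q R f - f"
    using P[of "totient Q * totient R"] P[OF pos(1)] P[OF pos(2)] pos assms(1)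
    unfolding bar by (cases "P = 1") auto
  show "of_nat Q dvd off_bar P Q R f"
    using E[of Q "totient R"] E[of Q 1] assms(2,4)
    unfolding bar by (cases "Q = 1") auto
  show "of_nat R dvd off_bar P Q R f"
    using E[of R "totient Q"] E[of R 1] assms(3,5)
    unfolding bar mult.commute[of "totient Q"] by (cases "R = 1") auto
qed

lemma diag_bar_in: "f \<in> pseries_in X \<Longrightarrow> diag_bar P Q R f \<in> pseries_in X"
  and off_bar_in: "f \<in> pseries_in X \<Longrightarrow> off_bar P Q R f \<in> pseries_in X"
proof -
  have nat: "of_nat k \<in> pseries_in X" for k
    by (induction k) (auto intro: pseries_in_subring)
  have diff: "g - h \<in> pseries_in X" if "g \<in> pseries_in X" "h \<in> pseries_in X"
    for g h :: "('a, int) pseries"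
    using pseries_in_subring(4)[OF that(1) pseries_in_subring(3)[OF that(2)]] by simp
  note closed = nat diff pseries_in_subring(1,2,4,5)
  show "f \<in> pseries_in X \<Longrightarrow> diag_bar P Q R f \<in> pseries_in X"
    unfolding diag_bar_def by (simp add: closed del: of_nat_power of_nat_mult)
  show "f \<in> pseries_in X \<Longrightarrow> off_bar P Q R f \<in> pseries_in X"
    unfolding off_bar_def by (simp add: closed del: of_nat_power of_nat_mult)
qed

section \<open>Idempotent matrices of order two\<close>

lemma mat2_in_iff:
  "A \<in> mat2_in S \<longleftrightarrow> A $ 1 $ 1 \<in> S \<and> A $ 1 $ 2 \<in> S \<and> A $ 2 $ 1 \<in> S \<and> A $ 2 $ 2 \<in> S"
  by (auto simp: mat2_in_def forall_2)

lemma mat2_nth [simp]: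
  "mat2 a b c d $ 1 $ 1 = a" "mat2 a b c d $ 1 $ 2 = b"
  "mat2 a b c d $ 2 $ 1 = c" "mat2 a b c d $ 2 $ 2 = d"
  by (simp_all add: mat2_def)

lemma reduce_mat_nth: "reduce_mat A $ i $ j = reduce_ps (A $ i $ j)"
  by (simp add: reduce_mat_def)

lemma mat_idempotent_iff:
  fixes A :: "'a :: comm_ring_1 ^ 2 ^ 2"
  shows "A ** A = A \<longleftrightarrow>
    A $ 1 $ 1 * A $ 1 $ 1 + A $ 1 $ 2 * A $ 2 $ 1 = A $ 1 $ 1 \<and>
    A $ 1 $ 1 * A $ 1 $ 2 + A $ 1 $ 2 * A $ 2 $ 2 = A $ 1 $ 2 \<and>
    A $ 2 $ 1 * A $ 1 $ 1 + A $ 2 $ 2 * A $ 2 $ 1 = A $ 2 $ 1 \<and>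
    A $ 2 $ 1 * A $ 1 $ 2 + A $ 2 $ 2 * A $ 2 $ 2 = A $ 2 $ 2"
  by (simp add: vec_eq_iff forall_2 matrix_matrix_mult_def sum_2)

text \<open>
  With \<open>A = (a, b; c, d)\<close>, the first identity is \<open>det (A\<^sup>2) = (det A)\<^sup>2\<close>. The others are the entries of
  \<open>adj A * (A\<^sup>2 - A) = det A * (A - 1)\<close> for the adjugate \<open>adj A\<close>, which explains the multipliers in the
  proof.
\<close>

lemma idempotent_mat2_det:
  fixes a b c d :: "'a :: comm_ring_1"
  assumes id: "a * a + b * c = a" "a * b + b * d = b" "c * a + d * c = c" "c * b + d * d = d"
  defines "\<delta> \<equiv> a * d - b * c"
  shows "\<delta> * \<delta> = \<delta>"
    and "\<delta> * (a - 1) = 0" "\<delta> * b = 0" "\<delta> * c = 0" "\<delta> * (d - 1) = 0"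
proof -
  have "\<delta> * \<delta> = (a * a + b * c) * (c * b + d * d) - (a * b + b * d) * (c * a + d * c)"
    by (simp add: \<delta>_def algebra_simps)
  then show "\<delta> * \<delta> = \<delta>" by (simp only: id) (simp add: \<delta>_def)
  have "\<delta> * (a - 1) = d * (a * a + b * c - a) - b * (c * a + d * c - c)"
    by (simp add: \<delta>_def algebra_simps)
  then show "\<delta> * (a - 1) = 0" by (simp add: id)
  have "\<delta> * b = d * (a * b + b * d - b) - b * (c * b + d * d - d)"
    by (simp add: \<delta>_def algebra_simps)
  then show "\<delta> * b = 0" by (simp add: id)
  have "\<delta> * c = a * (c * a + d * c - c) - c * (a * a + b * c - a)"
    by (simp add: \<delta>_def algebra_simps)
  then show "\<delta> * c = 0" by (simp add: id)
  have "\<delta> * (d - 1) = a * (c * b + d * d - d) - c * (a * b + b * d - b)"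
    by (simp add: \<delta>_def algebra_simps)
  then show "\<delta> * (d - 1) = 0" by (simp add: id)
qed

text \<open>The previous lemma for the complementary idempotent \<open>1 - A\<close>, whose determinant is \<open>\<epsilon>\<close>.\<close>

lemma idempotent_mat2_det_compl:
  fixes a b c d :: "'a :: comm_ring_1"
  assumes id: "a * a + b * c = a" "a * b + b * d = b" "c * a + d * c = c" "c * b + d * d = d"
  defines "\<epsilon> \<equiv> (1 - a) * (1 - d) - b * c"
  shows "\<epsilon> * \<epsilon> = \<epsilon>"
    and "\<epsilon> * a = 0" "\<epsilon> * b = 0" "\<epsilon> * c = 0" "\<epsilon> * d = 0"
proof -
  have "(1 - a) * (1 - a) + - b * - c = 1 - a" "(1 - a) * - b + - b * (1 - d) = - b"
    "- c * (1 - a) + (1 - d) * - c = - c" "- c * - b + (1 - d) * (1 - d) = 1 - d"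
    using id by (simp_all add: algebra_simps)
  note det = idempotent_mat2_det[OF this]
  show "\<epsilon> * \<epsilon> = \<epsilon>" "\<epsilon> * a = 0" "\<epsilon> * b = 0" "\<epsilon> * c = 0" "\<epsilon> * d = 0"
    using det unfolding \<epsilon>_def by simp_all
qed

section \<open>Splitting the modulus\<close>

text \<open>
  Any decomposition of \<open>n\<close> along the product \<open>e * (1 - e)\<close> has coprime factors, since \<open>e\<close> and \<open>1 - e\<close>
  are coprime.
\<close>

lemma split_modulus_by_idempotent:
  fixes n :: nat and e :: int
  assumes "int n dvd e * (1 - e)"
  obtains A B where "n = A * B" "coprime A B" "int A dvd e" "int B dvd 1 - e"
proof -
  obtain x y where xy: "int n = x * y" "x dvd e" "y dvd 1 - e"
    using division_decomp[OF assms] by blast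
  show thesis
  proof
    show "n = nat \<bar>x\<bar> * nat \<bar>y\<bar>"
      using xy(1) by (metis abs_mult nat_abs_mult_distrib nat_int abs_of_nat)
    have "coprime e (1 - e)"
      by (rule coprimeI) (metis diff_add_cancel dvd_add)
    then have "coprime x y" using xy(2,3) by (metis coprime_divisors)
    then show "coprime (nat \<bar>x\<bar>) (nat \<bar>y\<bar>)" by (simp flip: coprime_int_iff)
    show "int (nat \<bar>x\<bar>) dvd e" "int (nat \<bar>y\<bar>) dvd 1 - e" using xy by simp_all
  qed
qed

text \<open>
  The idempotent \<open>e1\<close> (later \<open>det a\<close>) splits off the factor \<open>Q\<close> of rank 2; on the complementary
  factor \<open>e0\<close> (later \<open>det (1 - a)\<close>) separates rank 0 from rank 1.
\<close>

lemma split_modulus_by_two_idempotents: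
  fixes n :: nat and e1 e0 :: int
  assumes "int n dvd e1 * (1 - e1)" "int n dvd e0 * (1 - e0)"
  obtains P Q R where "n = P * Q * R" "coprime P Q" "coprime P R" "coprime Q R"
    "int P dvd e1" "int P dvd e0" "int Q dvd 1 - e1" "int R dvd 1 - e0"
proof -
  obtain A Q where A: "n = A * Q" "coprime A Q" "int A dvd e1" "int Q dvd 1 - e1"
    using split_modulus_by_idempotent[OF assms(1)] .
  have dvd_A: "int A dvd e0 * (1 - e0)" using A(1) assms(2) by (auto intro: dvd_mult_left)
  obtain P R where R: "A = P * R" "coprime P R" "int P dvd e0" "int R dvd 1 - e0"
    using split_modulus_by_idempotent[OF dvd_A] .
  show thesis
  proof
    show "n = P * Q * R" using A R by simp
    show "coprime P Q" "coprime Q R" using A(2) R(1) by (auto simp: coprime_commute)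
    show "int P dvd e1" using A(3) R(1) by (auto intro: dvd_mult_left)
  qed (use A R in auto)
qed

section \<open>The classification\<close>

text \<open>
  The conclusion is the form of one entry of \<open>A\<^sup>2 - A\<close>: the entries of \<open>A\<close> may be replaced by congruent
  ones when idempotence modulo \<open>k\<close> is checked.
\<close>

lemma dvd_mult_add_mult_diff_cong:
  fixes k :: "'a :: comm_ring_1"
  assumes "k dvd x - x'" "k dvd y - y'" "k dvd z - z'" "k dvd w - w'" "k dvd v - v'"
    and "k dvd x' * y' + z' * w' - v'"
  shows "k dvd x * y + z * w - v"
proof -
  have "x * y + z * w - v = (x' * y' + z' * w' - v') +
      ((x - x') * y + (y - y') * x') + ((z - z') * w + (w - w') * z') - (v - v')"
    by (simp add: algebra_simps)
  then show ?thesis using assms by (simp only: dvd_add dvd_diff dvd_mult2)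
qed

text \<open>
  Modulo \<open>P\<close> the matrix is \<open>(\<alpha>, \<beta>; \<gamma>, 1 - \<alpha>)\<close>, whose square is itself exactly when
  \<open>\<alpha> (1 - \<alpha>) = \<beta> \<gamma>\<close>; modulo \<open>Q\<close> it is the identity and modulo \<open>R\<close> it is zero.
\<close>

lemma reduce_idem_mat_idempotent:
  fixes \<alpha> \<beta> \<gamma> :: "('x, int) pseries"
  assumes n: "CARD('n :: nontriv) = P * Q * R"
    and PQR: "P > 0" "Q > 0" "R > 0" "coprime P Q" "coprime P R" "coprime Q R"
    and eq: "P > 1 \<longrightarrow> cong_ps (\<alpha> * (1 - \<alpha>)) (\<beta> * \<gamma>) P"
  defines "A \<equiv> reduce_mat (idem_mat P Q R \<alpha> \<beta> \<gamma>) :: ('x, 'n mod_ring) pseries ^ 2 ^ 2"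
  shows "A ** A = A"
proof -
  let ?a = "diag_bar P Q R \<alpha>" and ?b = "off_bar P Q R \<beta>"
    and ?c = "off_bar P Q R \<gamma>" and ?d = "diag_bar P Q R (1 - \<alpha>)"
  have crt: "of_nat (P * Q * R) dvd f"
    if "of_nat P dvd f" "of_nat Q dvd f" "of_nat R dvd f" for f :: "('x, int) pseries"
    using that PQR by (intro of_nat_mult_dvd_pseries) auto
  have P: "of_nat P dvd \<alpha> * (1 - \<alpha>) - \<beta> * \<gamma>"
    using eq PQR(1) by (cases "P = 1") (auto simp: cong_ps_iff_dvd)
  note a = diag_bar_cong[OF PQR, of \<alpha>] and d = diag_bar_cong[OF PQR, of "1 - \<alpha>"]
    and b = off_bar_cong[OF PQR, of \<beta>] and c = off_bar_cong[OF PQR, of \<gamma>]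
  note modP = dvd_mult_add_mult_diff_cong[where k = "of_nat P"]
  note modQ = dvd_mult_add_mult_diff_cong[where k = "of_nat Q"]
  have b': "of_nat Q dvd ?b - 0" "of_nat Q dvd ?c - 0" using b c by simp_all
  have "of_nat (P * Q * R) dvd ?a * ?a + ?b * ?c - ?a"
  proof (rule crt)
    have "\<alpha> * \<alpha> + \<beta> * \<gamma> - \<alpha> = - (\<alpha> * (1 - \<alpha>) - \<beta> * \<gamma>)" by (simp add: algebra_simps)
    then show "of_nat P dvd ?a * ?a + ?b * ?c - ?a"
      using P by (intro modP[OF a(1) a(1) b(1) c(1) a(1)]) (metis dvd_minus_iff)
    show "of_nat Q dvd ?a * ?a + ?b * ?c - ?a"
      by (rule modQ[OF a(2) a(2) b' a(2)]) simp
  qed (use a b c in \<open>simp add: dvd_add dvd_diff\<close>)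
  moreover have "of_nat (P * Q * R) dvd ?a * ?b + ?b * ?d - ?b"
  proof (rule crt)
    show "of_nat P dvd ?a * ?b + ?b * ?d - ?b"
      by (rule modP[OF a(1) b(1) b(1) d(1) b(1)]) (simp add: algebra_simps)
  qed (use b in \<open>simp_all add: dvd_add dvd_diff\<close>)
  moreover have "of_nat (P * Q * R) dvd ?c * ?a + ?d * ?c - ?c"
  proof (rule crt)
    show "of_nat P dvd ?c * ?a + ?d * ?c - ?c"
      by (rule modP[OF c(1) a(1) d(1) c(1) c(1)]) (simp add: algebra_simps)
  qed (use c in \<open>simp_all add: dvd_add dvd_diff\<close>)
  moreover have "of_nat (P * Q * R) dvd ?c * ?b + ?d * ?d - ?d"
  proof (rule crt)
    have "\<gamma> * \<beta> + (1 - \<alpha>) * (1 - \<alpha>) - (1 - \<alpha>) = - (\<alpha> * (1 - \<alpha>) - \<beta> * \<gamma>)"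
      by (simp add: algebra_simps)
    then show "of_nat P dvd ?c * ?b + ?d * ?d - ?d"
      using P by (intro modP[OF c(1) b(1) d(1) d(1) d(1)]) (metis dvd_minus_iff)
    show "of_nat Q dvd ?c * ?b + ?d * ?d - ?d"
      by (rule modQ[OF b'(2,1) d(2) d(2) d(2)]) simp
  qed (use b d in \<open>simp add: dvd_add dvd_diff\<close>)
  ultimately show ?thesis
    unfolding mat_idempotent_iff A_def reduce_mat_nth idem_mat_def mat2_nth
    by (simp only: reduce_ps_eq_iff n flip: reduce_ps_mult reduce_ps_add)
qed

text \<open>
  \<open>P\<close>, \<open>Q\<close>, \<open>R\<close> come from the two determinants, while \<open>\<alpha>\<close>, \<open>\<beta>\<close>, \<open>\<gamma>\<close> are arbitrary lifts of three
  entries of the given matrix: these lifts satisfy the required congruence modulo \<open>P\<close>, and the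
  formulas return the entries because they agree with them modulo \<open>P\<close>, \<open>Q\<close> and \<open>R\<close>.
\<close>

lemma idempotent_mat_is_reduce_idem_mat:
  fixes A :: "('x, 'n :: nontriv mod_ring) pseries ^ 2 ^ 2"
  assumes A: "A \<in> mat2_in (pseries_in X)" and idem: "A ** A = A"
  obtains P Q R :: nat and \<alpha> \<beta> \<gamma> :: "('x, int) pseries" where
    "CARD('n) = P * Q * R" "coprime P Q" "coprime P R" "coprime Q R"
    "\<alpha> \<in> pseries_in X" "\<beta> \<in> pseries_in X" "\<gamma> \<in> pseries_in X"
    "cong_ps (\<alpha> * (1 - \<alpha>)) (\<beta> * \<gamma>) P"
    "A = reduce_mat (idem_mat P Q R \<alpha> \<beta> \<gamma>)"
proof -
  let ?n = "CARD('n)"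
  let ?red = "reduce_ps :: _ \<Rightarrow> ('x, 'n mod_ring) pseries"
  from A obtain \<alpha> \<beta> \<gamma> \<eta> :: "('x, int) pseries" where
    lifts: "\<alpha> \<in> pseries_in X" "\<beta> \<in> pseries_in X" "\<gamma> \<in> pseries_in X" and
    red: "A $ 1 $ 1 = ?red \<alpha>" "A $ 1 $ 2 = ?red \<beta>" "A $ 2 $ 1 = ?red \<gamma>" "A $ 2 $ 2 = ?red \<eta>"
    unfolding mat2_in_iff by (metis reduce_ps_lift)
  define \<delta> where "\<delta> = \<alpha> * \<eta> - \<beta> * \<gamma>"
  define \<epsilon> where "\<epsilon> = (1 - \<alpha>) * (1 - \<eta>) - \<beta> * \<gamma>"
  note id = idem[unfolded mat_idempotent_iff red]
  note det1 = idempotent_mat2_det[OF id[THEN conjunct1] id[THEN conjunct2, THEN conjunct1]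
      id[THEN conjunct2, THEN conjunct2, THEN conjunct1]
      id[THEN conjunct2, THEN conjunct2, THEN conjunct2]]
  note det0 = idempotent_mat2_det_compl[OF id[THEN conjunct1] id[THEN conjunct2, THEN conjunct1]
      id[THEN conjunct2, THEN conjunct2, THEN conjunct1]
      id[THEN conjunct2, THEN conjunct2, THEN conjunct2]]
  have red\<delta>: "?red \<alpha> * ?red \<eta> - ?red \<beta> * ?red \<gamma> = ?red \<delta>"
    and red\<epsilon>: "(1 - ?red \<alpha>) * (1 - ?red \<eta>) - ?red \<beta> * ?red \<gamma> = ?red \<epsilon>"
    by (simp_all add: \<delta>_def \<epsilon>_def reduce_ps_hom)
  note det1 = det1[unfolded red\<delta>] and det0 = det0[unfolded red\<delta> red\<epsilon>]
  obtain e1 where e1: "?red \<delta> = of_int e1"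
    using idempotent_reduced_pseries_of_int[OF det1(1)] .
  obtain e0 where e0: "?red \<epsilon> = of_int e0"
    using idempotent_reduced_pseries_of_int[OF det0(1)] .
  have dvd_int: "int ?n dvd e" if "(of_int e :: ('x, 'n mod_ring) pseries) = 0" for e
  proof -
    have "of_nat ?n dvd (of_int e :: ('x, int) pseries)"
      using that by (simp flip: reduce_ps_eq_0_iff add: reduce_ps_of_int)
    then have "int ?n dvd coeff_ps (of_int e :: ('x, int) pseries) {#}"
      unfolding of_nat_dvd_pseries_iff ..
    then show ?thesis by (simp add: coeff_ps_of_int)
  qed
  have n1: "int ?n dvd e1 * (1 - e1)" and n0: "int ?n dvd e0 * (1 - e0)"
    using det1(1) det0(1) by (auto intro!: dvd_int simp: e1 e0 algebra_simps)
  obtain P Q R where n: "?n = P * Q * R"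
    and cop: "coprime P Q" "coprime P R" "coprime Q R"
    and dvd: "int P dvd e1" "int P dvd e0" "int Q dvd 1 - e1" "int R dvd 1 - e0"
    using split_modulus_by_two_idempotents[OF n1 n0] .
  have "P * Q * R > 0" by (simp flip: n)
  then have PQR: "P > 0" "Q > 0" "R > 0" "coprime P Q" "coprime P R" "coprime Q R"
    using cop by auto
  have n_dvd: "of_nat P dvd f" "of_nat Q dvd f" "of_nat R dvd f"
    if "of_nat ?n dvd f" for f :: "('x, int) pseries"
    using that unfolding n of_nat_mult
    by (blast dest: dvd_mult_left dvd_mult_right)+
  \<comment> \<open>\<open>\<delta>\<close> is 1 modulo \<open>Q\<close> and \<open>\<epsilon>\<close> is 1 modulo \<open>R\<close>, so there they cancel.\<close>
  have modQ: "of_nat Q dvd f" if "?red \<delta> * ?red f = 0" for f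
  proof -
    have "of_nat ?n dvd of_int e1 * f"
      using that by (simp flip: reduce_ps_eq_0_iff add: reduce_ps_hom e1)
    then have "of_nat Q dvd of_int e1 * f + of_int (1 - e1) * f"
      by (intro dvd_add n_dvd(2) dvd_mult2[OF of_nat_dvd_of_int[OF dvd(3)]])
    then show ?thesis by (simp add: algebra_simps)
  qed
  have modR: "of_nat R dvd f" if "?red \<epsilon> * ?red f = 0" for f
  proof -
    have "of_nat ?n dvd of_int e0 * f"
      using that by (simp flip: reduce_ps_eq_0_iff add: reduce_ps_hom e0)
    then have "of_nat R dvd of_int e0 * f + of_int (1 - e0) * f"
      by (intro dvd_add n_dvd(3) dvd_mult2[OF of_nat_dvd_of_int[OF dvd(4)]])
    then show ?thesis by (simp add: algebra_simps)
  qed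
  have "of_nat ?n dvd \<delta> - of_int e1" "of_nat ?n dvd \<epsilon> - of_int e0"
    by (simp_all flip: reduce_ps_eq_iff add: e1 e0 reduce_ps_of_int)
  then have P: "of_nat P dvd \<delta>" "of_nat P dvd \<epsilon>"
    using n_dvd(1) of_nat_dvd_of_int[OF dvd(1)] of_nat_dvd_of_int[OF dvd(2)]
    by (metis dvd_diff_left_iff)+
  \<comment> \<open>The trace is \<open>1 + \<delta> - \<epsilon>\<close>.\<close>
  have "\<eta> - (1 - \<alpha>) = \<delta> - \<epsilon>" by (simp add: \<delta>_def \<epsilon>_def algebra_simps)
  with P have trace: "of_nat P dvd \<eta> - (1 - \<alpha>)" by simp
  have "\<alpha> * (1 - \<alpha>) - \<beta> * \<gamma> = \<delta> - \<alpha> * (\<eta> - (1 - \<alpha>))"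
    by (simp add: \<delta>_def algebra_simps)
  with P(1) trace have "cong_ps (\<alpha> * (1 - \<alpha>)) (\<beta> * \<gamma>) P"
    by (simp add: cong_ps_iff_dvd)
  moreover have lift: "?red f = ?red g"
    if "of_nat P dvd f - h" "of_nat P dvd g - h" "of_nat Q dvd f - k" "of_nat Q dvd g - k"
      "of_nat R dvd f" "of_nat R dvd g" for f g h k
  proof -
    have "of_nat P dvd f - g" "of_nat Q dvd f - g" "of_nat R dvd f - g"
      using dvd_diff[OF that(1,2)] dvd_diff[OF that(3,4)] dvd_diff[OF that(5,6)] by simp_all
    then have "of_nat (P * Q * R) dvd f - g"
      using PQR by (intro of_nat_mult_dvd_pseries) auto
    then show ?thesis by (simp only: reduce_ps_eq_iff n)
  qed
  have "A = reduce_mat (idem_mat P Q R \<alpha> \<beta> \<gamma>)"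
  proof -
    have Q: "of_nat Q dvd \<alpha> - 1" "of_nat Q dvd \<beta>" "of_nat Q dvd \<gamma>" "of_nat Q dvd \<eta> - 1"
      using det1(2-5) by (auto intro!: modQ simp: reduce_ps_hom)
    have R: "of_nat R dvd \<alpha>" "of_nat R dvd \<beta>" "of_nat R dvd \<gamma>" "of_nat R dvd \<eta>"
      using det0(2-5) by (auto intro!: modR)
    have "?red \<alpha> = ?red (diag_bar P Q R \<alpha>)"
      using diag_bar_cong[OF PQR, of \<alpha>] Q(1) R(1) by (intro lift[of _ \<alpha> _ 1]) simp_all
    moreover have "?red \<beta> = ?red (off_bar P Q R \<beta>)"
      using off_bar_cong[OF PQR, of \<beta>] Q(2) R(2) by (intro lift[of _ \<beta> _ 0]) simp_all
    moreover have "?red \<gamma> = ?red (off_bar P Q R \<gamma>)"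
      using off_bar_cong[OF PQR, of \<gamma>] Q(3) R(3) by (intro lift[of _ \<gamma> _ 0]) simp_all
    moreover have "?red \<eta> = ?red (diag_bar P Q R (1 - \<alpha>))"
      using diag_bar_cong[OF PQR, of "1 - \<alpha>"] trace Q(4) R(4)
      by (intro lift[of _ "1 - \<alpha>" _ 1]) assumption+
    ultimately show ?thesis
      by (simp add: vec_eq_iff forall_2 reduce_mat_nth idem_mat_def red)
  qed
  ultimately show thesis using that n cop lifts by blast
qed

theorem theorem5:
  fixes X :: "'x set" and n :: nat
  assumes "n = CARD('n :: nontriv)" and "n > 1"
  shows "{a :: ('x, 'n mod_ring) pseries ^ 2 ^ 2. a \<in> mat2_in (pseries_in X) \<and> a ** a = a} =
    {a. \<exists>P Q R :: nat. \<exists>\<alpha> \<beta> \<gamma> :: ('x, int) pseries.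
        n = P * Q * R \<and> P > 0 \<and> Q > 0 \<and> R > 0 \<and>
        coprime P Q \<and> coprime P R \<and> coprime Q R \<and>
        \<alpha> \<in> pseries_in X \<and> \<beta> \<in> pseries_in X \<and> \<gamma> \<in> pseries_in X \<and>
        (P > 1 \<longrightarrow> cong_ps (\<alpha> * (1 - \<alpha>)) (\<beta> * \<gamma>) P) \<and>
        a = reduce_mat (idem_mat P Q R \<alpha> \<beta> \<gamma>)}"
proof (intro subset_antisym subsetI; clarify)
  fix a :: "('x, 'n mod_ring) pseries ^ 2 ^ 2"
  assume "a \<in> mat2_in (pseries_in X)" "a ** a = a"
  then obtain P Q R :: nat and \<alpha> \<beta> \<gamma> :: "('x, int) pseries" where
    n: "CARD('n) = P * Q * R" and
    rest: "coprime P Q" "coprime P R" "coprime Q R"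
      "\<alpha> \<in> pseries_in X" "\<beta> \<in> pseries_in X" "\<gamma> \<in> pseries_in X"
      "cong_ps (\<alpha> * (1 - \<alpha>)) (\<beta> * \<gamma>) P"
      "a = reduce_mat (idem_mat P Q R \<alpha> \<beta> \<gamma>)"
    by (rule idempotent_mat_is_reduce_idem_mat)
  have "n = P * Q * R" using n assms(1) by simp
  moreover from this have "P > 0" "Q > 0" "R > 0" using \<open>n > 1\<close> by (auto intro: gr0I)
  ultimately show "\<exists>P Q R. \<exists>\<alpha> \<beta> \<gamma> :: ('x, int) pseries.
      n = P * Q * R \<and> P > 0 \<and> Q > 0 \<and> R > 0 \<and>
      coprime P Q \<and> coprime P R \<and> coprime Q R \<and>
      \<alpha> \<in> pseries_in X \<and> \<beta> \<in> pseries_in X \<and> \<gamma> \<in> pseries_in X \<and>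
      (P > 1 \<longrightarrow> cong_ps (\<alpha> * (1 - \<alpha>)) (\<beta> * \<gamma>) P) \<and>
      a = reduce_mat (idem_mat P Q R \<alpha> \<beta> \<gamma>)"
    using rest by blast
next
  fix P Q R :: nat and \<alpha> \<beta> \<gamma> :: "('x, int) pseries"
  let ?A = "reduce_mat (idem_mat P Q R \<alpha> \<beta> \<gamma>) :: ('x, 'n mod_ring) pseries ^ 2 ^ 2"
  assume h: "n = P * Q * R" "P > 0" "Q > 0" "R > 0"
    "coprime P Q" "coprime P R" "coprime Q R"
    "P > 1 \<longrightarrow> cong_ps (\<alpha> * (1 - \<alpha>)) (\<beta> * \<gamma>) P"
    and X: "\<alpha> \<in> pseries_in X" "\<beta> \<in> pseries_in X" "\<gamma> \<in> pseries_in X"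
  have "1 - \<alpha> \<in> pseries_in X"
    using pseries_in_subring(4)[OF pseries_in_subring(2) pseries_in_subring(3)[OF X(1)]] by simp
  with X have "?A \<in> mat2_in (pseries_in X)"
    by (simp add: mat2_in_iff reduce_mat_nth idem_mat_def reduce_ps_in diag_bar_in off_bar_in)
  moreover have "CARD('n) = P * Q * R" using h(1) assms(1) by simp
  then have "?A ** ?A = ?A" using h(2-) by (rule reduce_idem_mat_idempotent)
  ultimately show "?A \<in> mat2_in (pseries_in X) \<and> ?A ** ?A = ?A" by blast
qed

end
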